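(* Let $\mathcal{K}$ be a class of similar algebras that is closed under subalgebras. Then $\mathcal{K}$ has the transferable injections property if and only if it has the one-sided amalgamation property and the extension property.
   Context: Similar algebras are algebras of the same signature. Let $\mathcal{K}$ be a class of similar algebras. In each of the following, $\mathbf{A},\mathbf{B},\mathbf{C}$ range over members of $\mathcal{K}$, $\varphi_B\colon\mathbf{A}\to\mathbf{B}$ is an embedding, $\varphi_C\colon\mathbf{A}\to\mathbf{C}$ is a homomorphism, and the required completion consists of a $\mathbf{D}\in\mathcal{K}$, a homomorphism $\psi_B\colon\mathbf{B}\to\mathbf{D}$, and an embedding $\psi_C\colon\mathbf{C}\to\mathbf{D}$ such that $\psi_B\varphi_B=\psi_C\varphi_C$. - $\mathcal{K}$ has the transferable injections property if such a completion exists for all such $\mathbf{A},\mathbf{B},\mathbf{C},\varphi_B,\varphi_C$ ($\varphi_C$ an arbitrary homomorphism). - $\mathcal{K}$ has the one-sided amalgamation property if such a completion exists whenever $\varphi_C$ is an embedding. - $\mathcal{K}$ has the extension property if such a completion exists whenever $\varphi_C$ is surjective. *)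

theory Defs
  imports "HOL-Library.FuncSet"
begin

text \<open>
  A signature has a set of operation symbols (possibly empty, hence a set rather than a whole
  type), each of finite arity.
\<close>

record 'f signature =
  symbols :: "'f set"
  arity :: "'f \<Rightarrow> nat"

record ('f, 'a) alg =
  universe :: "'a set"
  interp :: "'f \<Rightarrow> 'a list \<Rightarrow> 'a"

definition tuples :: "'a set \<Rightarrow> nat \<Rightarrow> 'a list set" where
  "tuples X n = {xs. set xs \<subseteq> X \<and> length xs = n}"

text \<open>
  Universes are nonempty. The extensional function space fixes the values of the operations
  outside their mathematical domain, so that two algebras with the same universe and the same
  operations are equal as records.
\<close>

definition is_algebra :: "'f signature \<Rightarrow> ('f, 'a) alg \<Rightarrow> bool" where
  "is_algebra \<Sigma> A \<longleftrightarrow>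
     universe A \<noteq> {} \<and>
     interp A \<in> (\<Pi>\<^sub>E f\<in>symbols \<Sigma>. tuples (universe A) (arity \<Sigma> f) \<rightarrow>\<^sub>E universe A)"

definition subalgebra :: "'f signature \<Rightarrow> ('f, 'a) alg \<Rightarrow> ('f, 'a) alg \<Rightarrow> bool" where
  "subalgebra \<Sigma> A B \<longleftrightarrow>
     is_algebra \<Sigma> A \<and> is_algebra \<Sigma> B \<and> universe A \<subseteq> universe B \<and>
     (\<forall>f\<in>symbols \<Sigma>. \<forall>xs\<in>tuples (universe A) (arity \<Sigma> f). interp A f xs = interp B f xs)"

definition homomorphism ::
    "'f signature \<Rightarrow> ('f, 'a) alg \<Rightarrow> ('f, 'b) alg \<Rightarrow> ('a \<Rightarrow> 'b) \<Rightarrow> bool" where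
  "homomorphism \<Sigma> A B h \<longleftrightarrow>
     h \<in> universe A \<rightarrow> universe B \<and>
     (\<forall>f\<in>symbols \<Sigma>. \<forall>xs\<in>tuples (universe A) (arity \<Sigma> f).
        h (interp A f xs) = interp B f (map h xs))"

definition embedding ::
    "'f signature \<Rightarrow> ('f, 'a) alg \<Rightarrow> ('f, 'b) alg \<Rightarrow> ('a \<Rightarrow> 'b) \<Rightarrow> bool" where
  "embedding \<Sigma> A B h \<longleftrightarrow> homomorphism \<Sigma> A B h \<and> inj_on h (universe A)"

definition surjective_homomorphism ::
    "'f signature \<Rightarrow> ('f, 'a) alg \<Rightarrow> ('f, 'b) alg \<Rightarrow> ('a \<Rightarrow> 'b) \<Rightarrow> bool" where
  "surjective_homomorphism \<Sigma> A B h \<longleftrightarrow>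
     homomorphism \<Sigma> A B h \<and> h ` universe A = universe B"

text \<open>
  A class of similar algebras is a set of algebras whose universes are subsets of a fixed but
  arbitrary type, which plays the role of the set-theoretic universe.
\<close>

definition class_of_similar_algebras :: "'f signature \<Rightarrow> ('f, 'a) alg set \<Rightarrow> bool" where
  "class_of_similar_algebras \<Sigma> K \<longleftrightarrow> (\<forall>A\<in>K. is_algebra \<Sigma> A)"

definition closed_under_subalgebras :: "'f signature \<Rightarrow> ('f, 'a) alg set \<Rightarrow> bool" where
  "closed_under_subalgebras \<Sigma> K \<longleftrightarrow> (\<forall>B\<in>K. \<forall>A. subalgebra \<Sigma> A B \<longrightarrow> A \<in> K)"

definition has_completion ::
    "'f signature \<Rightarrow> ('f, 'a) alg set \<Rightarrow> ('f, 'a) alg \<Rightarrow> ('f, 'a) alg \<Rightarrow> ('f, 'a) alg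
      \<Rightarrow> ('a \<Rightarrow> 'a) \<Rightarrow> ('a \<Rightarrow> 'a) \<Rightarrow> bool" where
  "has_completion \<Sigma> K A B C \<phi>B \<phi>C \<longleftrightarrow>
     (\<exists>D\<in>K. \<exists>\<psi>B \<psi>C. homomorphism \<Sigma> B D \<psi>B \<and> embedding \<Sigma> C D \<psi>C \<and>
        (\<forall>x\<in>universe A. \<psi>B (\<phi>B x) = \<psi>C (\<phi>C x)))"

definition transferable_injections_property :: "'f signature \<Rightarrow> ('f, 'a) alg set \<Rightarrow> bool" where
  "transferable_injections_property \<Sigma> K \<longleftrightarrow>
     (\<forall>A\<in>K. \<forall>B\<in>K. \<forall>C\<in>K. \<forall>\<phi>B \<phi>C.
        embedding \<Sigma> A B \<phi>B \<longrightarrow> homomorphism \<Sigma> A C \<phi>C \<longrightarrow>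
        has_completion \<Sigma> K A B C \<phi>B \<phi>C)"

definition one_sided_amalgamation_property :: "'f signature \<Rightarrow> ('f, 'a) alg set \<Rightarrow> bool" where
  "one_sided_amalgamation_property \<Sigma> K \<longleftrightarrow>
     (\<forall>A\<in>K. \<forall>B\<in>K. \<forall>C\<in>K. \<forall>\<phi>B \<phi>C.
        embedding \<Sigma> A B \<phi>B \<longrightarrow> embedding \<Sigma> A C \<phi>C \<longrightarrow>
        has_completion \<Sigma> K A B C \<phi>B \<phi>C)"

definition extension_property :: "'f signature \<Rightarrow> ('f, 'a) alg set \<Rightarrow> bool" where
  "extension_property \<Sigma> K \<longleftrightarrow>
     (\<forall>A\<in>K. \<forall>B\<in>K. \<forall>C\<in>K. \<forall>\<phi>B \<phi>C.
        embedding \<Sigma> A B \<phi>B \<longrightarrow> surjective_homomorphism \<Sigma> A C \<phi>C \<longrightarrow>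
        has_completion \<Sigma> K A B C \<phi>B \<phi>C)"

end

theory Submission
  imports Defs
begin

text \<open>
  The transferable injections property specialises to the other two, since embeddings and
  surjective homomorphisms are homomorphisms. Conversely, every homomorphism \<open>\<phi>C\<close> from \<open>A\<close> to \<open>C\<close>
  factors as a surjection onto its image \<open>E\<close> followed by the inclusion of \<open>E\<close> in \<open>C\<close>; closure
  under subalgebras puts \<open>E\<close> in the class. The two factors are handled one after the other: the
  extension property completes \<open>B\<close> and the surjection to some \<open>D\<close>, into which \<open>E\<close> embeds and
  \<open>B\<close> maps; the one-sided amalgamation property then completes the embeddings of \<open>E\<close> in \<open>D\<close> and
  in \<open>C\<close> to some \<open>F\<close>, into which \<open>C\<close> embeds and \<open>D\<close> maps (lemmas
  \<open>subalgebra_image_algebra\<close> and \<open>has_completion_paste\<close>).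
\<close>

lemma map_in_tuples:
  assumes "h \<in> X \<rightarrow> Y" and "xs \<in> tuples X n"
  shows "map h xs \<in> tuples Y n"
  using assms by (auto simp: tuples_def)

lemma homomorphism_compose:
  assumes g: "homomorphism \<Sigma> A B g" and h: "homomorphism \<Sigma> B C h"
  shows "homomorphism \<Sigma> A C (h \<circ> g)"
proof -
  have g_fun: "g \<in> universe A \<rightarrow> universe B" and h_fun: "h \<in> universe B \<rightarrow> universe C"
    using g h by (simp_all add: homomorphism_def)
  have "h (g (interp A f xs)) = interp C f (map (h \<circ> g) xs)"
    if f: "f \<in> symbols \<Sigma>" and xs: "xs \<in> tuples (universe A) (arity \<Sigma> f)" for f xs
  proof -
    have "g (interp A f xs) = interp B f (map g xs)"
      using g f xs by (simp add: homomorphism_def)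
    then show ?thesis
      using h f map_in_tuples[OF g_fun xs] by (simp add: homomorphism_def)
  qed
  then show ?thesis
    using g_fun h_fun by (auto simp: homomorphism_def)
qed

lemma embedding_subalgebra_inclusion:
  assumes "subalgebra \<Sigma> A B"
  shows "embedding \<Sigma> A B id"
  using assms by (auto simp: embedding_def homomorphism_def subalgebra_def)

text \<open>
  Restricting the operations to tuples of the image makes them extensional, as
  \<^const>\<open>is_algebra\<close> demands.
\<close>

definition image_algebra ::
    "'f signature \<Rightarrow> ('f, 'a) alg \<Rightarrow> ('f, 'b) alg \<Rightarrow> ('a \<Rightarrow> 'b) \<Rightarrow> ('f, 'b) alg" where
  "image_algebra \<Sigma> A B h =
     \<lparr>universe = h ` universe A,
      interp = (\<lambda>f\<in>symbols \<Sigma>. \<lambda>ys\<in>tuples (h ` universe A) (arity \<Sigma> f). interp B f ys)\<rparr>"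

text \<open>
  A tuple of elements of the image lifts entrywise to a tuple of the domain; applying the operation
  there and mapping the result forward shows that the image is closed under the operation.
\<close>

lemma subalgebra_image_algebra:
  assumes A: "is_algebra \<Sigma> A" and B: "is_algebra \<Sigma> B" and h: "homomorphism \<Sigma> A B h"
  shows "subalgebra \<Sigma> (image_algebra \<Sigma> A B h) B"
proof -
  have closed: "interp B f ys \<in> h ` universe A"
    if f: "f \<in> symbols \<Sigma>" and ys: "ys \<in> tuples (h ` universe A) (arity \<Sigma> f)" for f ys
  proof -
    have "ys \<in> map h ` lists (universe A)"
      using ys by (auto simp: tuples_def lists_image[symmetric])
    then obtain xs where xs: "set xs \<subseteq> universe A" "ys = map h xs"
      by auto
    then have tup: "xs \<in> tuples (universe A) (arity \<Sigma> f)"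
      using ys by (simp add: tuples_def)
    then have "interp A f xs \<in> universe A"
      using A f by (auto simp: is_algebra_def PiE_iff)
    moreover have "h (interp A f xs) = interp B f ys"
      using h f tup xs(2) by (simp add: homomorphism_def)
    ultimately show ?thesis
      by (metis imageI)
  qed
  have "is_algebra \<Sigma> (image_algebra \<Sigma> A B h)"
    using A closed by (auto simp: is_algebra_def image_algebra_def)
  moreover have "h ` universe A \<subseteq> universe B"
    using h by (auto simp: homomorphism_def)
  ultimately show ?thesis
    using B by (simp add: subalgebra_def image_algebra_def)
qed

lemma surjective_homomorphism_image_algebra:
  assumes h: "homomorphism \<Sigma> A B h"
  shows "surjective_homomorphism \<Sigma> A (image_algebra \<Sigma> A B h) h"
proof -
  have "map h xs \<in> tuples (h ` universe A) n" if "xs \<in> tuples (universe A) n" for xs n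
    using that by (auto intro: map_in_tuples)
  then show ?thesis
    using h by (simp add: surjective_homomorphism_def homomorphism_def image_algebra_def)
qed

text \<open>
  Commutative squares paste along a common side. This reduces completing the composite
  \<open>\<iota> \<circ> \<pi>\<close> to completing \<open>\<pi>\<close> and then \<open>\<iota>\<close>; the second completion is asked for every \<open>D\<close> and
  every embedding \<open>\<epsilon>\<close> because the first completion supplies them only existentially.
\<close>

lemma has_completion_paste:
  assumes \<pi>: "\<pi> \<in> universe A \<rightarrow> universe E"
    and first: "has_completion \<Sigma> K A B E \<phi>B \<pi>"
    and second: "\<And>D \<epsilon>. D \<in> K \<Longrightarrow> embedding \<Sigma> E D \<epsilon> \<Longrightarrow> has_completion \<Sigma> K E D C \<epsilon> \<iota>"
  shows "has_completion \<Sigma> K A B C \<phi>B (\<iota> \<circ> \<pi>)"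
proof -
  obtain D \<beta> \<epsilon> where D: "D \<in> K" "homomorphism \<Sigma> B D \<beta>" "embedding \<Sigma> E D \<epsilon>"
    and left: "\<forall>x\<in>universe A. \<beta> (\<phi>B x) = \<epsilon> (\<pi> x)"
    using first unfolding has_completion_def by blast
  obtain F \<delta> \<psi>C where F: "F \<in> K" "homomorphism \<Sigma> D F \<delta>" "embedding \<Sigma> C F \<psi>C"
    and right: "\<forall>y\<in>universe E. \<delta> (\<epsilon> y) = \<psi>C (\<iota> y)"
    using second[OF D(1,3)] unfolding has_completion_def by blast
  have "homomorphism \<Sigma> B F (\<delta> \<circ> \<beta>)"
    using D(2) F(2) by (rule homomorphism_compose)
  moreover have "\<forall>x\<in>universe A. (\<delta> \<circ> \<beta>) (\<phi>B x) = \<psi>C ((\<iota> \<circ> \<pi>) x)"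
    using \<pi> left right by (simp add: Pi_iff)
  ultimately show ?thesis
    unfolding has_completion_def using F(1,3) by blast
qed

theorem proposition4p1:
  fixes \<Sigma> :: "'f signature" and K :: "('f, 'a) alg set"
  assumes "class_of_similar_algebras \<Sigma> K"
    and "closed_under_subalgebras \<Sigma> K"
  shows "transferable_injections_property \<Sigma> K \<longleftrightarrow>
    one_sided_amalgamation_property \<Sigma> K \<and> extension_property \<Sigma> K"
proof
  assume "transferable_injections_property \<Sigma> K"
  then show "one_sided_amalgamation_property \<Sigma> K \<and> extension_property \<Sigma> K"
    by (simp add: transferable_injections_property_def one_sided_amalgamation_property_def
        extension_property_def embedding_def surjective_homomorphism_def)
next
  assume "one_sided_amalgamation_property \<Sigma> K \<and> extension_property \<Sigma> K"
  then have amalg: "one_sided_amalgamation_property \<Sigma> K" and ext: "extension_property \<Sigma> K"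
    by simp_all
  show "transferable_injections_property \<Sigma> K"
    unfolding transferable_injections_property_def
  proof (intro ballI allI impI)
    fix A B C \<phi>B \<phi>C
    assume K: "A \<in> K" "B \<in> K" "C \<in> K"
      and \<phi>B: "embedding \<Sigma> A B \<phi>B" and \<phi>C: "homomorphism \<Sigma> A C \<phi>C"
    let ?E = "image_algebra \<Sigma> A C \<phi>C"
    have sub: "subalgebra \<Sigma> ?E C"
      using assms(1) K \<phi>C by (simp add: class_of_similar_algebras_def subalgebra_image_algebra)
    then have E: "?E \<in> K"
      using assms(2) K by (auto simp: closed_under_subalgebras_def)
    have onto: "surjective_homomorphism \<Sigma> A ?E \<phi>C"
      using \<phi>C by (rule surjective_homomorphism_image_algebra)
    have incl: "embedding \<Sigma> ?E C id"
      using sub by (rule embedding_subalgebra_inclusion)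
    have "has_completion \<Sigma> K A B C \<phi>B (id \<circ> \<phi>C)"
    proof (rule has_completion_paste)
      show "\<phi>C \<in> universe A \<rightarrow> universe ?E"
        using onto by (simp add: surjective_homomorphism_def homomorphism_def)
      show "has_completion \<Sigma> K A B ?E \<phi>B \<phi>C"
        using ext K E \<phi>B onto by (simp add: extension_property_def)
      show "has_completion \<Sigma> K ?E D C \<epsilon> id" if "D \<in> K" "embedding \<Sigma> ?E D \<epsilon>" for D \<epsilon>
        using amalg K E incl that by (simp add: one_sided_amalgamation_property_def)
    qed
    then show "has_completion \<Sigma> K A B C \<phi>B \<phi>C"
      by simp
  qed
qed

end
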